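(* Let $p\ge 1$ be an integer, let $\alpha=(\alpha_1,\dots,\alpha_p)$ with $\alpha_i\in(0,\infty)\setminus\mathbb{N}$ for every $i\in\{1,\dots,p\}$, let $m\in\mathbb{N}$, and let $\mathbf{f}:[0,\infty)\times\mathbb{R}^{p(m+1)}\to\mathbb{R}^p$ be a given function. Consider the fractional-order differential system $$D^{\alpha}\mathbf{x}(t)=\mathbf{f}(t,\mathbf{x}(t),\mathbf{x}'(t),\dots,\mathbf{x}^{(m)}(t)),\qquad t\ge 0,$$ where $D^{\alpha}\mathbf{x}(t)=(D^{\alpha_1}x_1(t),\dots,D^{\alpha_p}x_p(t))^T$ and $D^{\alpha_i}$, $i\in\{1,\dots,p\}$, is understood as one of the Riemann-Liouville, Caputo or Grunwald-Letnikov fractional-order derivatives. If $\mathbf{f}$ is constant with respect to its first argument (i.e. the system is autonomous), then there are no non-constant periodic solutions (of any period $\tau>0$) of class $C^{\mathbf{n}}$ of this system, where $\mathbf{n}=([\alpha_1]+1,\dots,[\alpha_p]+1)$.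
   Context: $[\cdot]$ denotes the integer part. A function $\mathbf{x}=(x_1,\dots,x_p)^T:[0,\infty)\to\mathbb{R}^p$ is of class $C^{\mathbf{n}}$, with $\mathbf{n}=(n_1,\dots,n_p)$, if each $x_i$ is $n_i$ times continuously differentiable. It is periodic with period $\tau>0$ if $\mathbf{x}(t+\tau)=\mathbf{x}(t)$ for all $t\ge 0$. A solution is a function $\mathbf{x}$ for which the derivatives appearing in the system exist and the system is satisfied. For $\beta\in(0,\infty)\setminus\mathbb{N}$, $n=[\beta]+1$ and $g$ of class $C^n$, the fractional-order derivatives of order $\beta$ with lower limit $0$ are: Riemann-Liouville: $${}^{RL}D^{\beta}g(t)=\frac{1}{\Gamma(n-\beta)}\left(\frac{d}{dt}\right)^n\int_0^t (t-s)^{n-\beta-1}g(s)\,ds;$$ Caputo: $${}^{C}D^{\beta}g(t)=\frac{1}{\Gamma(n-\beta)}\int_0^t (t-s)^{n-\beta-1}g^{(n)}(s)\,ds;$$ Grunwald-Letnikov: $${}^{GL}D^{\beta}g(t)=\lim_{h\to 0}h^{-\beta}\sum_{r=0}^{[t/h]}(-1)^r\binom{\beta}{r}g(t-rh),$$ where the limit is taken over $h>0$ and $\binom{\beta}{r}=\frac{\beta(\beta-1)\cdots(\beta-r+1)}{r!}$. *)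

theory Defs
  imports "HOL-Analysis.Analysis"
begin

text \<open>
  Functions on the half-line \<open>[0,\<infinity>)\<close> are total functions on \<^typ>\<open>real\<close> of which only the values
  at nonnegative arguments matter; accordingly all derivatives are taken within \<open>{0..}\<close>, i.e.
  they are one-sided at \<open>0\<close>.
\<close>

primrec nderiv :: "nat \<Rightarrow> (real \<Rightarrow> 'a::real_normed_vector) \<Rightarrow> real \<Rightarrow> 'a" where
  "nderiv 0 g = g"
| "nderiv (Suc k) g = (\<lambda>t. vector_derivative (nderiv k g) (at t within {0..}))"

definition times_differentiable :: "nat \<Rightarrow> (real \<Rightarrow> 'a::real_normed_vector) \<Rightarrow> bool" where
  "times_differentiable k g \<longleftrightarrow> (\<forall>j<k. nderiv j g differentiable_on {0..})"

definition C_class :: "nat \<Rightarrow> (real \<Rightarrow> 'a::real_normed_vector) \<Rightarrow> bool" where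
  "C_class k g \<longleftrightarrow> times_differentiable k g \<and> continuous_on {0..} (nderiv k g)"

definition C_class_vec :: "('p \<Rightarrow> nat) \<Rightarrow> (real \<Rightarrow> real ^ 'p::finite) \<Rightarrow> bool" where
  "C_class_vec n x \<longleftrightarrow> (\<forall>i. C_class (n i) (\<lambda>t. x t $ i))"

definition periodic_with :: "real \<Rightarrow> (real \<Rightarrow> 'a) \<Rightarrow> bool" where
  "periodic_with \<tau> x \<longleftrightarrow> \<tau> > 0 \<and> (\<forall>t\<ge>0. x (t + \<tau>) = x t)"

definition constant_fun :: "(real \<Rightarrow> 'a) \<Rightarrow> bool" where
  "constant_fun x \<longleftrightarrow> (\<exists>c. \<forall>t\<ge>0. x t = c)"

definition frac_ord :: "real \<Rightarrow> nat" where
  "frac_ord \<beta> = nat \<lfloor>\<beta>\<rfloor> + 1"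

text \<open>
  The kernel \<open>(t - s) powr (n - \<beta> - 1)\<close> is \<open>0\<close> at the endpoint \<open>s = t\<close>, where the exponent
  makes it singular; a single point does not affect the integrals.
\<close>

definition frac_kernel :: "real \<Rightarrow> real \<Rightarrow> real \<Rightarrow> real" where
  "frac_kernel \<beta> t s = (t - s) powr (real (frac_ord \<beta>) - \<beta> - 1)"

definition RL_deriv :: "real \<Rightarrow> (real \<Rightarrow> real) \<Rightarrow> real \<Rightarrow> real" where
  "RL_deriv \<beta> g t = 1 / Gamma (real (frac_ord \<beta>) - \<beta>) *
     nderiv (frac_ord \<beta>) (\<lambda>t. integral {0..t} (\<lambda>s. frac_kernel \<beta> t s * g s)) t"

definition RL_differentiable :: "real \<Rightarrow> (real \<Rightarrow> real) \<Rightarrow> bool" where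
  "RL_differentiable \<beta> g \<longleftrightarrow>
     (\<forall>t\<ge>0. (\<lambda>s. frac_kernel \<beta> t s * g s) integrable_on {0..t}) \<and>
     times_differentiable (frac_ord \<beta>) (\<lambda>t. integral {0..t} (\<lambda>s. frac_kernel \<beta> t s * g s))"

definition Caputo_deriv :: "real \<Rightarrow> (real \<Rightarrow> real) \<Rightarrow> real \<Rightarrow> real" where
  "Caputo_deriv \<beta> g t = 1 / Gamma (real (frac_ord \<beta>) - \<beta>) *
     integral {0..t} (\<lambda>s. frac_kernel \<beta> t s * nderiv (frac_ord \<beta>) g s)"

definition Caputo_differentiable :: "real \<Rightarrow> (real \<Rightarrow> real) \<Rightarrow> bool" where
  "Caputo_differentiable \<beta> g \<longleftrightarrow>
     times_differentiable (frac_ord \<beta>) g \<and>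
     (\<forall>t\<ge>0. (\<lambda>s. frac_kernel \<beta> t s * nderiv (frac_ord \<beta>) g s) integrable_on {0..t})"

definition GL_quotient :: "real \<Rightarrow> (real \<Rightarrow> real) \<Rightarrow> real \<Rightarrow> real \<Rightarrow> real" where
  "GL_quotient \<beta> g t h =
     h powr (- \<beta>) * (\<Sum>r = 0..nat \<lfloor>t / h\<rfloor>. (- 1) ^ r * (\<beta> gchoose r) * g (t - real r * h))"

definition GL_deriv :: "real \<Rightarrow> (real \<Rightarrow> real) \<Rightarrow> real \<Rightarrow> real" where
  "GL_deriv \<beta> g t = Lim (at_right 0) (GL_quotient \<beta> g t)"

definition GL_differentiable :: "real \<Rightarrow> (real \<Rightarrow> real) \<Rightarrow> bool" where
  "GL_differentiable \<beta> g \<longleftrightarrow> (\<forall>t\<ge>0. \<exists>l. (GL_quotient \<beta> g t \<longlongrightarrow> l) (at_right 0))"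

datatype frac_kind = Riemann_Liouville | Caputo | Grunwald_Letnikov

fun frac_deriv :: "frac_kind \<Rightarrow> real \<Rightarrow> (real \<Rightarrow> real) \<Rightarrow> real \<Rightarrow> real" where
  "frac_deriv Riemann_Liouville = RL_deriv"
| "frac_deriv Caputo = Caputo_deriv"
| "frac_deriv Grunwald_Letnikov = GL_deriv"

fun frac_differentiable :: "frac_kind \<Rightarrow> real \<Rightarrow> (real \<Rightarrow> real) \<Rightarrow> bool" where
  "frac_differentiable Riemann_Liouville = RL_differentiable"
| "frac_differentiable Caputo = Caputo_differentiable"
| "frac_differentiable Grunwald_Letnikov = GL_differentiable"

text \<open>
  The right-hand side \<open>f\<close> takes the time and the list \<open>[x t, x' t, \<dots>, x\<^sup>(\<^sup>m\<^sup>) t]\<close>; a point of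
  \<open>\<real>\<^sup>p\<^sup>(\<^sup>m\<^sup>+\<^sup>1\<^sup>)\<close> is a list of length \<open>m + 1\<close> of vectors in \<open>\<real>\<^sup>p\<close>. The values of \<open>f\<close> at negative
  times or at lists of other lengths are irrelevant. The kind of fractional derivative may be
  chosen separately for each component.
\<close>

definition frac_solution ::
  "('p \<Rightarrow> frac_kind) \<Rightarrow> real ^ 'p \<Rightarrow> nat \<Rightarrow> (real \<Rightarrow> (real ^ 'p) list \<Rightarrow> real ^ 'p)
     \<Rightarrow> (real \<Rightarrow> real ^ 'p::finite) \<Rightarrow> bool" where
  "frac_solution K \<alpha> m f x \<longleftrightarrow>
     times_differentiable m x \<and>
     (\<forall>i. frac_differentiable (K i) (\<alpha> $ i) (\<lambda>s. x s $ i)) \<and>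
     (\<forall>t\<ge>0. (\<chi> i. frac_deriv (K i) (\<alpha> $ i) (\<lambda>s. x s $ i) t) =
        f t (map (\<lambda>k. nderiv k x t) [0..<m + 1]))"

definition autonomous :: "nat \<Rightarrow> (real \<Rightarrow> (real ^ 'p) list \<Rightarrow> real ^ 'p::finite) \<Rightarrow> bool" where
  "autonomous m f \<longleftrightarrow>
     (\<forall>s\<ge>0. \<forall>t\<ge>0. \<forall>X. length X = m + 1 \<longrightarrow> f s X = f t X)"

end

theory Submission
  imports Defs
begin

text \<open>
  If the system is autonomous, a periodic solution \<open>x\<close> makes every \<open>D\<^sup>\<alpha> x\<^sub>i\<close> periodic. For each of the
  three derivatives, comparing the values at \<open>t\<close> and \<open>t + \<tau>\<close> leaves only the contribution of the
  first period \<open>[0, \<tau>]\<close> to the memory, that is \<open>\<integral>\<^sub>0\<^sup>\<tau> (t + \<tau> - s)\<^sup>b h s ds = 0\<close> for all \<open>t > 0\<close>,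
  where \<open>b < 0\<close> and \<open>h\<close> is \<open>g\<close> (Riemann-Liouville, Grunwald-Letnikov; \<open>b = - \<beta> - 1\<close>) or its \<open>n\<close>-th
  derivative (Caputo; \<open>b = n - \<beta> - 1\<close>). Differentiating repeatedly in \<open>t\<close> shows that \<open>h\<close> is
  orthogonal to \<open>(t + \<tau> - s)\<^sup>b\<close> times every polynomial in \<open>1 / (t + \<tau> - s)\<close>, so \<open>h = 0\<close> by
  Stone-Weierstrass.
\<close>

section \<open>Periodicity of derivatives\<close>

text \<open>The half-line has a right neighbourhood of each of its points, so derivatives within
  \<open>{0..}\<close> are unique even at the endpoint 0.\<close>

lemma at_within_Ici_neq_bot:
  fixes t :: real
  assumes "t \<ge> 0"
  shows "at t within {0..} \<noteq> bot"
proof -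
  have "at t within {t..t+1} \<le> at t within {0..}"
    using assms by (intro at_le) auto
  moreover have "at t within {t..t+1} \<noteq> bot"
    by (simp add: trivial_limit_within islimpt_Icc)
  ultimately show ?thesis
    by (metis bot.extremum_uniqueI)
qed

lemma nderiv_has_vector_derivative:
  assumes "times_differentiable k g" "j < k" "t \<ge> 0"
  shows "(nderiv j g has_vector_derivative nderiv (Suc j) g t) (at t within {0..})"
  using assms by (auto simp: times_differentiable_def differentiable_on_def vector_derivative_works)

lemma nderiv_shift_has_vector_derivative:
  assumes "times_differentiable k g" "j < k" "t \<ge> 0" "\<tau> \<ge> 0"
  shows "((\<lambda>t. nderiv j g (t + \<tau>)) has_vector_derivative nderiv (Suc j) g (t + \<tau>)) (at t within {0..})"
proof -
  have "(nderiv j g has_vector_derivative nderiv (Suc j) g (t + \<tau>)) (at (t + \<tau>) within {0..})"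
    using assms by (intro nderiv_has_vector_derivative) auto
  \<comment> \<open>The shift maps \<open>{0..}\<close> onto \<open>{\<tau>..}\<close>, a subset of
    \<open>{0..}\<close>; the chain rule within a set asks for the derivative of the outer function
    on this image.\<close>
  then have "(nderiv j g has_vector_derivative nderiv (Suc j) g (t + \<tau>))
      (at (t + \<tau>) within (\<lambda>t. t + \<tau>) ` {0..})"
    by (rule has_vector_derivative_within_subset) (use assms in auto)
  moreover have "((\<lambda>t. t + \<tau>) has_vector_derivative 1) (at t within {0..})"
    by (auto intro!: derivative_eq_intros)
  ultimately show ?thesis
    using vector_diff_chain_within[of "\<lambda>t. t + \<tau>" 1 t "{0..}" "nderiv j g"] by (simp add: o_def)
qed

lemma periodic_with_nderiv:
  assumes "times_differentiable k g" "periodic_with \<tau> g" "j \<le> k"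
  shows "periodic_with \<tau> (nderiv j g)"
  using assms(3)
proof (induction j)
  case 0
  then show ?case using assms(2) by simp
next
  case (Suc j)
  then have per: "periodic_with \<tau> (nderiv j g)" and j: "j < k" by auto
  have "nderiv (Suc j) g (t + \<tau>) = nderiv (Suc j) g t" if "t \<ge> 0" for t
  proof -
    have "((\<lambda>t. nderiv j g (t + \<tau>)) has_vector_derivative nderiv (Suc j) g (t + \<tau>)) (at t within {0..})"
      using per that j assms(1)
      by (intro nderiv_shift_has_vector_derivative) (auto simp: periodic_with_def)
    then have "(nderiv j g has_vector_derivative nderiv (Suc j) g (t + \<tau>)) (at t within {0..})"
      by (rule has_vector_derivative_transform[rotated 2])
        (use per that in \<open>auto simp: periodic_with_def\<close>)
    then show ?thesis
      using nderiv_has_vector_derivative[OF assms(1) j that]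
        vector_derivative_unique_within[OF at_within_Ici_neq_bot[OF that]] by blast
  qed
  with per show ?case by (simp add: periodic_with_def)
qed

lemma zero_on_period_imp_zero:
  fixes g :: "real \<Rightarrow> real"
  assumes "periodic_with \<tau> g" "\<And>t. t \<in> {0..\<tau>} \<Longrightarrow> g t = 0" "t \<ge> 0"
  shows "g t = 0"
proof -
  have \<tau>: "\<tau> > 0" and per: "\<And>t. t \<ge> 0 \<Longrightarrow> g (t + \<tau>) = g t"
    using assms(1) by (auto simp: periodic_with_def)
  have "g t = 0" if "t \<ge> 0" "t \<le> real k * \<tau>" for t k
    using that
  proof (induction k arbitrary: t)
    case 0
    then show ?case using assms(2) \<tau> by auto
  next
    case (Suc k)
    show ?case
    proof (cases "t \<le> \<tau>")
      case True
      then show ?thesis using Suc.prems assms(2) by auto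
    next
      case False
      then have "g (t - \<tau>) = 0"
        using Suc.prems by (intro Suc.IH) (auto simp: algebra_simps)
      then show ?thesis using per[of "t - \<tau>"] False by simp
    qed
  qed
  moreover obtain k where "t / \<tau> < real k" using reals_Archimedean2 by blast
  then have "t \<le> real k * \<tau>" using \<tau> by (simp add: field_simps)
  ultimately show ?thesis using assms(3) by blast
qed

text \<open>Descend from order \<open>k\<close> to order 0: if the derivative of order
  \<open>j + 1\<close> is a constant \<open>c\<close>, the one of order \<open>j\<close> is affine
  with slope \<open>c\<close>, and its periodicity forces \<open>c = 0\<close>.\<close>

lemma nderiv_zero_periodic_imp_constant:
  fixes g :: "real \<Rightarrow> real"
  assumes td: "times_differentiable k g" and per: "periodic_with \<tau> g"
    and zero: "\<And>t. t \<ge> 0 \<Longrightarrow> nderiv k g t = 0"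
  shows "constant_fun g"
proof -
  have "constant_fun (nderiv (k - i) g)" if "i \<le> k" for i
    using that
  proof (induction i)
    case 0
    then show ?case using zero by (auto simp: constant_fun_def)
  next
    case (Suc i)
    define j where "j = k - Suc i"
    have j: "j < k" "k - i = Suc j" using Suc.prems by (auto simp: j_def)
    obtain c where c: "\<And>t. t \<ge> 0 \<Longrightarrow> nderiv (Suc j) g t = c"
      using Suc j by (auto simp: constant_fun_def)
    have "\<exists>d. \<forall>t\<in>{0..}. nderiv j g t - c * t = d"
    proof (rule has_vector_derivative_zero_constant)
      show "((\<lambda>t. nderiv j g t - c * t) has_vector_derivative 0) (at t within {0..})"
        if "t \<in> {0..}" for t
        using nderiv_has_vector_derivative[OF td j(1), of t] c[of t] that
        by (auto intro!: derivative_eq_intros)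
    qed auto
    then obtain d where d: "\<And>t. t \<ge> 0 \<Longrightarrow> nderiv j g t = c * t + d"
      by (force simp: algebra_simps)
    have "periodic_with \<tau> (nderiv j g)"
      using periodic_with_nderiv[OF td per] j by auto
    then have "\<tau> > 0" "nderiv j g (0 + \<tau>) = nderiv j g 0" by (auto simp: periodic_with_def)
    then have "c = 0" using d[of \<tau>] d[of 0] by auto
    then show ?case unfolding j_def[symmetric] constant_fun_def using d by auto
  qed
  from this[of k] show ?thesis by simp
qed

section \<open>Orthogonality to the kernels\<close>

lemma kernel_integrable:
  fixes h :: "real \<Rightarrow> real"
  assumes "continuous_on {0..\<tau>} h" "t > 0"
  shows "continuous_on {0..\<tau>} (\<lambda>s. (t + \<tau> - s) powr b * h s)"
    and "(\<lambda>s. (t + \<tau> - s) powr b * h s) integrable_on {0..\<tau>}"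
proof -
  show "continuous_on {0..\<tau>} (\<lambda>s. (t + \<tau> - s) powr b * h s)"
    using assms by (intro continuous_intros) auto
  then show "(\<lambda>s. (t + \<tau> - s) powr b * h s) integrable_on {0..\<tau>}"
    by (rule integrable_continuous_real)
qed

text \<open>For \<open>t > 0\<close> the base \<open>t + \<tau> - s\<close> stays at least
  \<open>t\<close> on \<open>[0, \<tau>]\<close>, away from the singularity of the power, so
  Leibniz's rule applies for every real exponent. It is used on the convex set
  \<open>{0<..}\<close>, whose openness then turns the derivative within it into a full one.\<close>

lemma kernel_integral_has_vector_derivative:
  fixes h :: "real \<Rightarrow> real"
  assumes h: "continuous_on {0..\<tau>} h" and t: "t > 0"
  shows "((\<lambda>t. integral {0..\<tau>} (\<lambda>s. (t + \<tau> - s) powr b * h s)) has_vector_derivative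
           b * integral {0..\<tau>} (\<lambda>s. (t + \<tau> - s) powr (b - 1) * h s)) (at t)"
proof -
  have "((\<lambda>t. integral (cbox 0 \<tau>) (\<lambda>s. (t + \<tau> - s) powr b * h s)) has_field_derivative
      integral (cbox 0 \<tau>) (\<lambda>s. b * ((t + \<tau> - s) powr (b - 1) * h s))) (at t within {0<..})"
  proof (rule leibniz_rule_field_derivative
      [where fx = "\<lambda>t s. b * ((t + \<tau> - s) powr (b - 1) * h s)"])
    show "((\<lambda>t. (t + \<tau> - s) powr b * h s) has_field_derivative
        b * ((t + \<tau> - s) powr (b - 1) * h s)) (at t within {0<..})"
      if "t \<in> {0<..}" "s \<in> cbox 0 \<tau>" for t s
      using that by (auto intro!: derivative_eq_intros)
    show "(\<lambda>s. (t + \<tau> - s) powr b * h s) integrable_on cbox 0 \<tau>" if "t \<in> {0<..}" for t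
      using kernel_integrable[OF h] that by simp
    have "continuous_on ({0<..} \<times> cbox 0 \<tau>) (\<lambda>p. h (snd p))"
      by (rule continuous_on_compose2[OF h]) (auto intro!: continuous_intros)
    then show "continuous_on ({0<..} \<times> cbox 0 \<tau>)
        (\<lambda>(t, s). b * ((t + \<tau> - s) powr (b - 1) * h s))"
      unfolding split_beta by (intro continuous_intros) auto
  qed (use t in auto)
  then have "((\<lambda>t. integral {0..\<tau>} (\<lambda>s. (t + \<tau> - s) powr b * h s)) has_field_derivative
      b * integral {0..\<tau>} (\<lambda>s. (t + \<tau> - s) powr (b - 1) * h s)) (at t)"
    using t at_within_open[of t "{0<..}"] by simp
  then show ?thesis by (simp add: has_real_derivative_iff_has_vector_derivative)
qed

text \<open>The substitution \<open>y = inverse (c - s)\<close> maps \<open>[0, \<tau>]\<close>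
  bijectively onto a compact interval of positive reals. By Weierstrass, \<psi> is a uniform limit
  of polynomials in \<open>y\<close>, each of them orthogonal to \<psi>; hence the integral of the
  square of \<psi> vanishes.\<close>

lemma inverse_powers_orthogonal_imp_zero:
  fixes \<psi> :: "real \<Rightarrow> real"
  assumes \<psi>: "continuous_on {0..\<tau>} \<psi>" and \<tau>: "\<tau> > 0" and c: "c > \<tau>"
    and orth: "\<And>k. integral {0..\<tau>} (\<lambda>s. inverse (c - s) ^ k * \<psi> s) = 0"
    and s: "s \<in> {0..\<tau>}"
  shows "\<psi> s = 0"
proof -
  have poly_orth: "integral {0..\<tau>} (\<lambda>s. q (inverse (c - s)) * \<psi> s) = 0"
    and poly_int: "(\<lambda>s. q (inverse (c - s)) * \<psi> s) integrable_on {0..\<tau>}"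
    if "real_polynomial_function q" for q :: "real \<Rightarrow> real"
  proof -
    obtain a n where q: "q = (\<lambda>x. \<Sum>i\<le>n. a i * x ^ i)"
      using \<open>real_polynomial_function q\<close> by (auto simp: real_polynomial_function_iff_sum)
    have int: "(\<lambda>s. inverse (c - s) ^ i * \<psi> s) integrable_on {0..\<tau>}" for i
      using \<psi> c by (intro integrable_continuous_real continuous_intros) auto
    have "((\<lambda>s. inverse (c - s) ^ i * \<psi> s) has_integral 0) {0..\<tau>}" for i
      using integrable_integral[OF int[of i]] orth by simp
    then have "((\<lambda>s. \<Sum>i\<le>n. a i * (inverse (c - s) ^ i * \<psi> s)) has_integral (\<Sum>i\<le>n. a i * 0)) {0..\<tau>}"
      by (intro has_integral_sum has_integral_mult_right) auto
    then have "((\<lambda>s. q (inverse (c - s)) * \<psi> s) has_integral 0) {0..\<tau>}"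
      by (simp add: q sum_distrib_right mult.assoc)
    then show "integral {0..\<tau>} (\<lambda>s. q (inverse (c - s)) * \<psi> s) = 0"
      and "(\<lambda>s. q (inverse (c - s)) * \<psi> s) integrable_on {0..\<tau>}" by (auto simp: integral_unique)
  qed
  have "compact (\<psi> ` {0..\<tau>})"
    using \<psi> by (intro compact_continuous_image) auto
  then have "bounded (\<psi> ` {0..\<tau>})" by (rule compact_imp_bounded)
  then obtain B where B: "B > 0" "\<And>s. s \<in> {0..\<tau>} \<Longrightarrow> \<bar>\<psi> s\<bar> \<le> B"
    by (auto simp: bounded_pos)
  have sq_int: "(\<lambda>s. \<psi> s * \<psi> s) integrable_on {0..\<tau>}"
    using \<psi> by (intro integrable_continuous_real continuous_intros)
  have "\<bar>integral {0..\<tau>} (\<lambda>s. \<psi> s * \<psi> s)\<bar> \<le> 0 + e" if "e > 0" for e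
  proof -
    \<comment> \<open>The error integrand below is at most \<open>d * B\<close> on an interval of
      length \<tau>, which integrates to exactly \<open>e\<close>.\<close>
    define d where "d = e / (B * \<tau>)"
    have "d > 0" using that B \<tau> by (simp add: d_def)
    \<comment> \<open>This is \<psi> in the variable \<open>y\<close>, with
      \<open>s = c - inverse y\<close>.\<close>
    have "continuous_on {inverse c..inverse (c - \<tau>)} (\<lambda>y. \<psi> (c - inverse y))"
    proof (rule continuous_on_compose2[OF \<psi>])
      have y0: "y > 0" if "inverse c \<le> y" for y :: real
        using that c \<tau> by (smt (verit) positive_imp_inverse_positive)
      then show "continuous_on {inverse c..inverse (c - \<tau>)} (\<lambda>y. c - inverse y)"
        using c \<tau> by (intro continuous_intros) auto
      have "c - \<tau> \<le> inverse y \<and> inverse y \<le> c" if y: "inverse c \<le> y" "y \<le> inverse (c - \<tau>)" for y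
        using le_imp_inverse_le[OF y(1)] le_imp_inverse_le[OF y(2)] y0[OF y(1)] c \<tau>
        by (simp add: less_imp_le)
      then show "(\<lambda>y. c - inverse y) ` {inverse c..inverse (c - \<tau>)} \<subseteq> {0..\<tau>}" by force
    qed
    then obtain q where q: "real_polynomial_function q"
      "\<And>y. y \<in> {inverse c..inverse (c - \<tau>)} \<Longrightarrow> \<bar>\<psi> (c - inverse y) - q y\<bar> < d"
      using Stone_Weierstrass_real_polynomial_function[OF _ _ \<open>d > 0\<close>] compact_Icc by metis
    have approx: "\<bar>\<psi> s - q (inverse (c - s))\<bar> \<le> d" if "s \<in> {0..\<tau>}" for s
      using q(2)[of "inverse (c - s)"] that c by (auto simp: le_imp_inverse_le less_imp_le)
    have "integral {0..\<tau>} (\<lambda>s. \<psi> s * \<psi> s)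
        = integral {0..\<tau>} (\<lambda>s. \<psi> s * \<psi> s) - integral {0..\<tau>} (\<lambda>s. q (inverse (c - s)) * \<psi> s)"
      using poly_orth[OF q(1)] by simp
    also have "\<dots> = integral {0..\<tau>} (\<lambda>s. \<psi> s * \<psi> s - q (inverse (c - s)) * \<psi> s)"
      using sq_int poly_int[OF q(1)] by (simp add: integral_diff)
    finally have eq: "integral {0..\<tau>} (\<lambda>s. \<psi> s * \<psi> s) =
        integral {0..\<tau>} (\<lambda>s. \<psi> s * \<psi> s - q (inverse (c - s)) * \<psi> s)" .
    have "norm (integral {0..\<tau>} (\<lambda>s. \<psi> s * \<psi> s - q (inverse (c - s)) * \<psi> s))
        \<le> integral {0..\<tau>} (\<lambda>s. d * B)"
    proof (rule integral_norm_bound_integral)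
      show "(\<lambda>s. \<psi> s * \<psi> s - q (inverse (c - s)) * \<psi> s) integrable_on {0..\<tau>}"
        using sq_int poly_int[OF q(1)] by (rule integrable_diff)
      show "norm (\<psi> s * \<psi> s - q (inverse (c - s)) * \<psi> s) \<le> d * B" if "s \<in> {0..\<tau>}" for s
        using mult_mono[OF approx[OF that] B(2)[OF that]] \<open>d > 0\<close>
        by (simp add: abs_mult[symmetric] algebra_simps)
    qed auto
    also have "\<dots> = e" using B \<tau> by (simp add: d_def)
    finally show ?thesis using eq by simp
  qed
  then have "\<bar>integral {0..\<tau>} (\<lambda>s. \<psi> s * \<psi> s)\<bar> \<le> 0" by (rule field_le_epsilon)
  then have "integral {0..\<tau>} (\<lambda>s. \<psi> s * \<psi> s) = 0" by simp
  then have "\<forall>s\<in>{0..\<tau>}. \<psi> s * \<psi> s = 0"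
    using \<psi> \<tau> by (subst (asm) integral_eq_0_iff) (auto intro!: continuous_intros)
  then show ?thesis using s by simp
qed

text \<open>Each differentiation in \<open>t\<close> lowers the exponent by one and brings out a
  factor \<open>b - real k\<close>, nonzero because \<open>b < 0\<close>. At a single fixed
  \<open>t\<close> the function \<open>(t + \<tau> - s) powr b * h s\<close> is thus orthogonal to
  all powers of \<open>inverse (t + \<tau> - s)\<close>, hence zero, and its first factor is
  positive.\<close>

lemma kernel_orthogonal_imp_zero:
  fixes h :: "real \<Rightarrow> real"
  assumes h: "continuous_on {0..\<tau>} h" and \<tau>: "\<tau> > 0" and b: "b < 0"
    and orth: "\<And>t. t > 0 \<Longrightarrow> integral {0..\<tau>} (\<lambda>s. (t + \<tau> - s) powr b * h s) = 0"
    and s: "s \<in> {0..\<tau>}"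
  shows "h s = 0"
proof -
  have all: "integral {0..\<tau>} (\<lambda>s. (t + \<tau> - s) powr (b - real k) * h s) = 0" if "t > 0" for k t
    using that
  proof (induction k arbitrary: t)
    case 0
    then show ?case using orth by simp
  next
    case (Suc k)
    let ?I = "\<lambda>c t. integral {0..\<tau>} (\<lambda>s. (t + \<tau> - s) powr c * h s)"
    \<comment> \<open>By the induction hypothesis the integral with exponent
      \<open>b - real k\<close> is zero on all of \<open>{0<..}\<close>, so the zero function
      inherits its derivative.\<close>
    have "((\<lambda>t. 0) has_vector_derivative (b - real k) * ?I (b - real k - 1) t) (at t)"
      by (rule has_vector_derivative_transform_within_open
          [OF kernel_integral_has_vector_derivative[OF h Suc.prems], of "{0<..}"])
        (use Suc in auto)
    then have "(b - real k) * ?I (b - real k - 1) t = 0"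
      using vector_derivative_unique_at has_vector_derivative_const by blast
    then show ?case using b by (simp add: algebra_simps)
  qed
  \<comment> \<open>The choice \<open>t = 1\<close> is arbitrary; any positive value gives
    \<open>c = t + \<tau> > \<tau>\<close>.\<close>
  have "(1 + \<tau> - s) powr b * h s = 0"
  proof (rule inverse_powers_orthogonal_imp_zero[OF _ \<tau> _ _ s, of _ "1 + \<tau>"])
    show "continuous_on {0..\<tau>} (\<lambda>s. (1 + \<tau> - s) powr b * h s)"
      using kernel_integrable[OF h] by simp
    show "integral {0..\<tau>} (\<lambda>s. inverse (1 + \<tau> - s) ^ k * ((1 + \<tau> - s) powr b * h s)) = 0" for k
    proof -
      have eq: "inverse (1 + \<tau> - s) ^ k * ((1 + \<tau> - s) powr b * h s) = (1 + \<tau> - s) powr (b - real k) * h s"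
        if "s \<in> {0..\<tau>}" for s
        using that by (simp add: powr_diff powr_realpow power_inverse field_simps)
      show ?thesis using all[of 1 k] by (subst integral_cong[OF eq]) auto
    qed
  qed simp
  then show ?thesis using s by simp
qed

text \<open>Split the integral up to \<open>t + \<tau>\<close> at \<tau>. Translating the second
  piece back by \<tau> gives the integral up to \<open>t\<close>, since \<open>h\<close> is periodic
  and the kernel depends only on the difference of its arguments.\<close>

lemma memory_integral_shift:
  fixes h :: "real \<Rightarrow> real"
  assumes per: "periodic_with \<tau> h" and t: "t \<ge> 0"
    and int: "\<And>t. t \<ge> 0 \<Longrightarrow> (\<lambda>s. (t - s) powr b * h s) integrable_on {0..t}"
  shows "integral {0..t + \<tau>} (\<lambda>s. (t + \<tau> - s) powr b * h s) - integral {0..t} (\<lambda>s. (t - s) powr b * h s)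
    = integral {0..\<tau>} (\<lambda>s. (t + \<tau> - s) powr b * h s)"
proof -
  let ?f = "\<lambda>s. (t + \<tau> - s) powr b * h s"
  have \<tau>: "\<tau> > 0" using per by (simp add: periodic_with_def)
  have "integral {0..\<tau>} ?f + integral {\<tau>..t + \<tau>} ?f = integral {0..t + \<tau>} ?f"
    using int[of "t + \<tau>"] t \<tau> by (intro Henstock_Kurzweil_Integration.integral_combine) auto
  moreover have "integral {0..t} (?f \<circ> (+) \<tau>) = integral {0 + \<tau>..t + \<tau>} ?f"
    by (rule integral_shift_Icc_real)
  moreover have "integral {0..t} (?f \<circ> (+) \<tau>) = integral {0..t} (\<lambda>s. (t - s) powr b * h s)"
    by (rule integral_cong) (use per in \<open>auto simp: periodic_with_def algebra_simps\<close>)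
  ultimately show ?thesis by simp
qed

section \<open>Periodic fractional derivatives\<close>

lemma continuous_on_Icc_of_times_differentiable:
  assumes "times_differentiable (frac_ord \<beta>) g"
  shows "continuous_on {0..\<tau>} g"
proof -
  have "g differentiable_on {0..}"
    using assms by (force simp: times_differentiable_def frac_ord_def dest: spec[of _ 0])
  then show ?thesis
    using differentiable_imp_continuous_on continuous_on_subset by fastforce
qed

text \<open>Since \<beta> is not an integer, \<open>frac_ord \<beta> - \<beta>\<close> lies strictly
  between 0 and 1: \<open>Gamma\<close> is positive there, and the kernel exponent is
  negative.\<close>

lemma frac_ord_bounds:
  assumes "\<beta> > 0" "\<beta> \<notin> \<nat>"
  shows "\<beta> < real (frac_ord \<beta>)" "real (frac_ord \<beta>) < \<beta> + 1"
proof -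
  have eq: "real (frac_ord \<beta>) = of_int \<lfloor>\<beta>\<rfloor> + 1" using assms by (simp add: frac_ord_def)
  have "of_int \<lfloor>\<beta>\<rfloor> \<noteq> \<beta>"
  proof
    assume "of_int \<lfloor>\<beta>\<rfloor> = \<beta>"
    moreover have "real (nat \<lfloor>\<beta>\<rfloor>) = of_int \<lfloor>\<beta>\<rfloor>" using assms(1) by simp
    ultimately show False using assms(2) of_nat_in_Nats by metis
  qed
  then show "\<beta> < real (frac_ord \<beta>)" "real (frac_ord \<beta>) < \<beta> + 1"
    unfolding eq by linarith+
qed

lemma Gamma_frac_ord_neq_0:
  assumes "\<beta> > 0" "\<beta> \<notin> \<nat>"
  shows "Gamma (real (frac_ord \<beta>) - \<beta>) \<noteq> 0"
proof -
  have "Gamma (real (frac_ord \<beta>) - \<beta>) > 0"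
    using frac_ord_bounds[OF assms] by (intro Gamma_real_pos) simp
  then show ?thesis by (rule less_imp_neq[symmetric])
qed

section \<open>The Caputo and Riemann-Liouville derivatives\<close>

text \<open>The orthogonality concerns the derivative \<open>h\<close> of order \<open>n\<close>, so
  only \<open>h = 0\<close> follows and \<open>g\<close> may be a nonzero constant, which the Caputo
  derivative indeed annihilates.\<close>

lemma periodic_Caputo_imp_constant:
  assumes \<beta>: "\<beta> > 0" "\<beta> \<notin> \<nat>" and per: "periodic_with \<tau> g" and C: "C_class (frac_ord \<beta>) g"
    and diff: "Caputo_differentiable \<beta> g" and D: "periodic_with \<tau> (Caputo_deriv \<beta> g)"
  shows "constant_fun g"
proof -
  define n where "n = frac_ord \<beta>"
  define h where "h = nderiv n g"
  have td: "times_differentiable n g" and cont: "continuous_on {0..} h"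
    using C by (auto simp: C_class_def n_def h_def)
  have perh: "periodic_with \<tau> h" using periodic_with_nderiv[OF td per] by (simp add: h_def)
  have \<tau>: "\<tau> > 0" using per by (simp add: periodic_with_def)
  have G: "Gamma (real n - \<beta>) \<noteq> 0"
    using Gamma_frac_ord_neq_0[OF \<beta>] by (simp add: n_def)
  have zero: "integral {0..\<tau>} (\<lambda>s. (t + \<tau> - s) powr (real n - \<beta> - 1) * h s) = 0" if "t > 0" for t
  proof -
    have "Caputo_deriv \<beta> g (t + \<tau>) = Caputo_deriv \<beta> g t"
      using D that by (simp add: periodic_with_def)
    then have "integral {0..t + \<tau>} (\<lambda>s. (t + \<tau> - s) powr (real n - \<beta> - 1) * h s)
        = integral {0..t} (\<lambda>s. (t - s) powr (real n - \<beta> - 1) * h s)"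
      using G by (simp add: Caputo_deriv_def frac_kernel_def n_def h_def)
    then show ?thesis
      using memory_integral_shift[OF perh, of t "real n - \<beta> - 1"] diff that
      by (simp add: Caputo_differentiable_def frac_kernel_def n_def h_def)
  qed
  have "h t = 0" if "t \<ge> 0" for t
  proof (rule zero_on_period_imp_zero[OF perh _ that])
    show "h s = 0" if "s \<in> {0..\<tau>}" for s
      by (rule kernel_orthogonal_imp_zero[OF continuous_on_subset[OF cont] \<tau> _ zero that])
        (use frac_ord_bounds[OF \<beta>] in \<open>auto simp: n_def\<close>)
  qed
  then show ?thesis
    using nderiv_zero_periodic_imp_constant[OF td per] by (simp add: h_def)
qed

text \<open>The difference \<open>G (t + \<tau>) - G t\<close> is an integral over the first period,
  whose kernel is regular for \<open>t > 0\<close>. It can therefore be differentiated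
  \<open>n\<close> times under the integral sign, and periodicity of the fractional derivative makes
  the result vanish. Here \<open>g\<close> itself turns out to be zero.\<close>

lemma periodic_RL_imp_constant:
  assumes \<beta>: "\<beta> > 0" "\<beta> \<notin> \<nat>" and per: "periodic_with \<tau> g"
    and cont: "continuous_on {0..\<tau>} g"
    and diff: "RL_differentiable \<beta> g" and D: "periodic_with \<tau> (RL_deriv \<beta> g)"
  shows "constant_fun g"
proof -
  define n where "n = frac_ord \<beta>"
  define a where "a = real n - \<beta> - 1"
  define G where "G = (\<lambda>t. integral {0..t} (\<lambda>s. (t - s) powr a * g s))"
  \<comment> \<open>Up to the factor \<open>(\<Prod>j<k. a - real j)\<close>, \<open>H k\<close> is
    the derivative of \<open>H 0\<close> of order \<open>k\<close>; at \<open>k = n\<close> the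
    exponent is \<open>- \<beta> - 1\<close>.\<close>
  define H where "H = (\<lambda>k t. integral {0..\<tau>} (\<lambda>s. (t + \<tau> - s) powr (a - real k) * g s))"
  have int: "(\<lambda>s. (t - s) powr a * g s) integrable_on {0..t}" if "t \<ge> 0" for t
    using diff that by (auto simp: RL_differentiable_def frac_kernel_def a_def n_def)
  have td: "times_differentiable n G"
    using diff by (auto simp: RL_differentiable_def frac_kernel_def a_def n_def G_def)
  have \<tau>: "\<tau> > 0" using per by (simp add: periodic_with_def)
  have a: "a < 0" using frac_ord_bounds[OF \<beta>] by (simp add: a_def n_def)
  have Gam: "Gamma (real n - \<beta>) \<noteq> 0"
    using Gamma_frac_ord_neq_0[OF \<beta>] by (simp add: n_def)
  have diffs: "nderiv k G (t + \<tau>) - nderiv k G t = (\<Prod>j<k. a - real j) * H k t"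
    if "k \<le> n" "t > 0" for k t
    using that
  proof (induction k arbitrary: t)
    case 0
    then show ?case using memory_integral_shift[OF per _ int, of t] by (simp add: G_def H_def)
  next
    case (Suc k)
    let ?P = "\<Prod>j<k. a - real j"
    have "(H k has_vector_derivative (a - real k) * H (Suc k) t) (at t within {0<..})"
      using kernel_integral_has_vector_derivative[OF cont \<open>t > 0\<close>, of "a - real k"]
      by (auto simp: H_def algebra_simps intro: has_vector_derivative_at_within)
    then have "((\<lambda>t. ?P * H k t) has_vector_derivative ?P * ((a - real k) * H (Suc k) t))
        (at t within {0<..})"
      by (rule has_vector_derivative_mult_right)
    then have 1: "((\<lambda>t. nderiv k G (t + \<tau>) - nderiv k G t) has_vector_derivative
        ?P * ((a - real k) * H (Suc k) t)) (at t within {0<..})"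
      by (rule has_vector_derivative_transform[rotated 2]) (use Suc in auto)
    have "((\<lambda>t. nderiv k G (t + \<tau>) - nderiv k G t) has_vector_derivative
        nderiv (Suc k) G (t + \<tau>) - nderiv (Suc k) G t) (at t within {0..})"
      using Suc.prems \<tau>
      by (intro has_vector_derivative_diff nderiv_shift_has_vector_derivative[OF td]
          nderiv_has_vector_derivative[OF td]) auto
    \<comment> \<open>The induction hypothesis identifies the difference only for
      \<open>t > 0\<close>, so the derivative coming from \<open>nderiv\<close> is restricted to
      \<open>{0<..}\<close> before the two are compared.\<close>
    then have 2: "((\<lambda>t. nderiv k G (t + \<tau>) - nderiv k G t) has_vector_derivative
        nderiv (Suc k) G (t + \<tau>) - nderiv (Suc k) G t) (at t within {0<..})"
      by (rule has_vector_derivative_within_subset) auto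
    show ?case
      using vector_derivative_unique_within[OF _ 2 1] Suc.prems
      at_within_open[of t "{0<..}"] by (simp add: mult.assoc del: nderiv.simps)
  qed
  have zero: "H n t = 0" if "t > 0" for t
  proof -
    have "RL_deriv \<beta> g (t + \<tau>) = RL_deriv \<beta> g t"
      using D that by (simp add: periodic_with_def)
    then have "nderiv n G (t + \<tau>) = nderiv n G t"
      using Gam by (simp add: RL_deriv_def frac_kernel_def n_def a_def G_def)
    then have "(\<Prod>j<n. a - real j) * H n t = 0" using diffs[of n t] that by simp
    moreover have "(\<Prod>j<n. a - real j) \<noteq> 0" using a by simp
    ultimately show ?thesis by simp
  qed
  have "g t = 0" if "t \<ge> 0" for t
  proof (rule zero_on_period_imp_zero[OF per _ that])
    show "g s = 0" if "s \<in> {0..\<tau>}" for s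
      by (rule kernel_orthogonal_imp_zero[OF cont \<tau> _ zero[unfolded H_def] that]) (use a in auto)
  qed
  then show ?thesis by (auto simp: constant_fun_def)
qed

section \<open>The Grunwald-Letnikov derivative as a limit of Riemann sums\<close>

text \<open>The numbers \<open>v N j\<close> need not be values of \<open>F\<close>; being uniformly
  close to \<open>F\<close> on each cell suffices. This leaves room for the binomial coefficients,
  which equal the kernel only asymptotically.\<close>

lemma uniform_Riemann_sums_tendsto:
  fixes F :: "real \<Rightarrow> real"
  assumes F: "continuous_on {0..T} F" and T: "T > 0"
    and unif: "\<And>e. e > 0 \<Longrightarrow> \<forall>\<^sub>F N in sequentially. \<forall>j<N.
      \<forall>s\<in>{real j * (T / N)..real (Suc j) * (T / N)}. \<bar>v N j - F s\<bar> \<le> e"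
  shows "(\<lambda>N. \<Sum>j<N. T / real N * v N j) \<longlonglongrightarrow> integral {0..T} F"
proof (rule LIMSEQ_I)
  fix e :: real assume e: "e > 0"
  \<comment> \<open>The total error \<open>T * d\<close> is then \<open>e / 2\<close>, strictly
    below \<open>e\<close>.\<close>
  define d where "d = e / (2 * T)"
  have d: "d > 0" using e T by (simp add: d_def)
  have bound: "\<bar>(\<Sum>j<N. T / real N * v N j) - integral {0..T} F\<bar> \<le> T * d"
    if N: "N > 0" and v: "\<forall>j<N. \<forall>s\<in>{real j * (T / N)..real (Suc j) * (T / N)}. \<bar>v N j - F s\<bar> \<le> d"
    for N
  proof -
    define \<delta> where "\<delta> = T / real N"
    have \<delta>: "\<delta> > 0" "real N * \<delta> = T" using T N by (auto simp: \<delta>_def)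
    \<comment> \<open>Induction on the number of cells: each adds at most
      \<open>\<delta> * d\<close> to the error.\<close>
    have "\<bar>(\<Sum>j<k. \<delta> * v N j) - integral {0..real k * \<delta>} F\<bar> \<le> real k * \<delta> * d" if "k \<le> N" for k
      using that
    proof (induction k)
      case 0
      then show ?case by simp
    next
      case (Suc k)
      have le: "real (Suc k) * \<delta> \<le> T" "real k * \<delta> \<le> real (Suc k) * \<delta>"
        using Suc.prems \<delta> by (metis mult_right_mono of_nat_le_iff less_imp_le, simp add: mult_right_mono)
      have int: "F integrable_on {u..w}" if "0 \<le> u" "w \<le> T" for u w
        using that by (intro integrable_continuous_real continuous_on_subset[OF F]) auto
      have comb: "integral {0..real k * \<delta>} F + integral {real k * \<delta>..real (Suc k) * \<delta>} F
          = integral {0..real (Suc k) * \<delta>} F"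
        using \<delta> le by (intro Henstock_Kurzweil_Integration.integral_combine int) auto
      have close: "\<bar>v N k - F s\<bar> \<le> d" if "s \<in> {real k * \<delta>..real (Suc k) * \<delta>}" for s
        using v Suc.prems that unfolding \<delta>_def by simp
      have "((\<lambda>s. v N k - F s) has_integral
          (real (Suc k) * \<delta> - real k * \<delta>) *\<^sub>R v N k - integral {real k * \<delta>..real (Suc k) * \<delta>} F)
          {real k * \<delta>..real (Suc k) * \<delta>}"
        using le \<delta> has_integral_const_real[of "v N k" "real k * \<delta>" "real (Suc k) * \<delta>"]
        by (intro has_integral_diff integrable_integral int) (auto simp del: of_nat_Suc)
      then have "\<bar>(real (Suc k) * \<delta> - real k * \<delta>) *\<^sub>R v N k - integral {real k * \<delta>..real (Suc k) * \<delta>} F\<bar>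
          \<le> d * (real (Suc k) * \<delta> - real k * \<delta>)"
        using has_integral_bound[of d "\<lambda>s. v N k - F s" _ "real k * \<delta>" "real (Suc k) * \<delta>"]
          close d le by (simp del: of_nat_Suc)
      moreover have "real (Suc k) * \<delta> - real k * \<delta> = \<delta>" by (simp add: algebra_simps)
      ultimately have "\<bar>\<delta> * v N k - integral {real k * \<delta>..real (Suc k) * \<delta>} F\<bar> \<le> \<delta> * d"
        by (simp add: mult.commute)
      then show ?case using Suc comb by (simp add: algebra_simps)
    qed
    from this[of N] \<delta> show ?thesis by (simp add: \<delta>_def)
  qed
  have "\<forall>\<^sub>F N in sequentially. \<bar>(\<Sum>j<N. T / real N * v N j) - integral {0..T} F\<bar> < e"
    using unif[OF d] eventually_gt_at_top[of 0]
  proof eventually_elim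
    case (elim N)
    then have "\<bar>(\<Sum>j<N. T / real N * v N j) - integral {0..T} F\<bar> \<le> T * d" by (intro bound) auto
    also have "\<dots> < e" using e T by (simp add: d_def)
    finally show ?case .
  qed
  then show "\<exists>N0. \<forall>N\<ge>N0. norm ((\<Sum>j<N. T / real N * v N j) - integral {0..T} F) < e"
    by (simp add: eventually_sequentially)
qed

text \<open>This is \<open>gbinomial_asymptotic\<close> with the exponential written as a power. It
  links the binomial weights to the kernel \<open>r powr (- \<beta> - 1)\<close>. The index 0 is
  excluded because \<open>0 powr (\<beta> + 1)\<close> is 0, whereas the exponential with
  \<open>ln 0 = 0\<close> is 1.\<close>

lemma GL_coeff_asymptotic:
  "(\<lambda>r. (- 1) ^ r * (\<beta> gchoose r) * real r powr (\<beta> + 1)) \<longlonglongrightarrow> inverse (Gamma (- \<beta>))"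
  for \<beta> :: real
proof (rule Lim_transform_eventually[OF gbinomial_asymptotic])
  show "\<forall>\<^sub>F r in sequentially. (\<beta> gchoose r) / ((- 1) ^ r / exp ((\<beta> + 1) * of_real (ln (real r))))
      = (- 1) ^ r * (\<beta> gchoose r) * real r powr (\<beta> + 1)"
    using eventually_gt_at_top[of 0]
  proof eventually_elim
    case (elim r)
    then show ?case by (cases "even r") (simp_all add: powr_def)
  qed
qed

text \<open>
  For step size \<open>\<tau> / N\<close> the terms of the sum at \<open>t + \<tau>\<close> not matched by a term at \<open>t\<close> are exactly
  \<open>N\<close>; listed backwards they sample \<open>g\<close> once in each of the \<open>N\<close> equal parts of \<open>[0, \<tau>]\<close>.
\<close>

lemma GL_quotient_shift:
  fixes g :: "real \<Rightarrow> real"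
  assumes per: "periodic_with \<tau> g" and t: "t \<ge> 0" and N: "N > 0"
  defines "h \<equiv> \<tau> / real N"
  defines "M \<equiv> nat \<lfloor>t / h\<rfloor>"
  shows "GL_quotient \<beta> g (t + \<tau>) h - GL_quotient \<beta> g t h =
    h powr (- \<beta>) * (\<Sum>j<N. (- 1) ^ (M + N - j) * (\<beta> gchoose (M + N - j)) *
      g (t + \<tau> - real (M + N - j) * h))"
proof -
  have \<tau>: "\<tau> > 0" and per': "\<And>t. t \<ge> 0 \<Longrightarrow> g (t + \<tau>) = g t"
    using per by (auto simp: periodic_with_def)
  have h: "h > 0" "\<tau> / h = real N" using \<tau> N by (auto simp: h_def)
  let ?c = "\<lambda>r. (- 1) ^ r * (\<beta> gchoose r) * g (t + \<tau> - real r * h)"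
  have "(t + \<tau>) / h = t / h + of_int (int N)" using h by (simp add: add_divide_distrib)
  then have "\<lfloor>(t + \<tau>) / h\<rfloor> = \<lfloor>t / h\<rfloor> + int N" by (simp only: floor_add_int)
  then have M: "nat \<lfloor>(t + \<tau>) / h\<rfloor> = M + N" using t h by (simp add: M_def nat_add_distrib)
  have "?c r = (- 1) ^ r * (\<beta> gchoose r) * g (t - real r * h)" if "r \<in> {0..M}" for r
  proof -
    \<comment> \<open>Periodicity is available only at nonnegative arguments;
      \<open>r \<le> M\<close> guarantees \<open>t - real r * h \<ge> 0\<close>.\<close>
    have "real r \<le> t / h" using that t h by (simp add: M_def le_nat_floor le_nat_iff le_floor_iff)
    then have "t - real r * h \<ge> 0" using h by (simp add: field_simps)
    from per'[OF this] show ?thesis by (simp add: algebra_simps)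
  qed
  then have "(\<Sum>r = 0..M. (- 1) ^ r * (\<beta> gchoose r) * g (t - real r * h)) = (\<Sum>r = 0..M. ?c r)"
    by (rule sum.cong[OF refl, symmetric])
  moreover have "(\<Sum>r = 0..M + N. ?c r) = (\<Sum>r = 0..M. ?c r) + (\<Sum>r = M + 1..M + N. ?c r)"
    by (rule sum.ub_add_nat) simp
  moreover have "(\<Sum>r = M + 1..M + N. ?c r) = (\<Sum>j<N. ?c (M + N - j))"
    by (rule sum.reindex_bij_witness[of _ "\<lambda>j. M + N - j" "\<lambda>r. M + N - r"]) auto
  ultimately show ?thesis
    unfolding GL_quotient_def M M_def[symmetric] by (simp add: algebra_simps)
qed

text \<open>Along the steps \<open>\<tau> / N\<close> the difference of the quotients at
  \<open>t + \<tau>\<close> and \<open>t\<close> is a perturbed Riemann sum converging to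
  \<open>L\<close> times the integral of \<open>F\<close> over the first period. Periodicity makes
  the limit 0, and \<open>L\<close> is nonzero.\<close>

lemma periodic_GL_imp_constant:
  assumes \<beta>: "\<beta> > 0" "\<beta> \<notin> \<nat>" and per: "periodic_with \<tau> g"
    and cont: "continuous_on {0..\<tau>} g"
    and diff: "GL_differentiable \<beta> g" and D: "periodic_with \<tau> (GL_deriv \<beta> g)"
  shows "constant_fun g"
proof -
  have \<tau>: "\<tau> > 0" using per by (simp add: periodic_with_def)
  define L where "L = inverse (Gamma (- \<beta>))"
  \<comment> \<open>The total function \<open>Gamma\<close> is zero exactly at the nonpositive
    integers, its poles.\<close>
  have "- \<beta> \<notin> \<int>\<^sub>\<le>\<^sub>0"
    using \<beta>(2) by (auto elim!: nonpos_Ints_cases')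
  then have L: "L \<noteq> 0" by (simp add: L_def Gamma_eq_zero_iff)
  define w where "w r = (- 1) ^ r * (\<beta> gchoose r) * real r powr (\<beta> + 1)" for r
  have w: "w \<longlonglongrightarrow> L" unfolding w_def L_def by (rule GL_coeff_asymptotic)
  have steps: "filterlim (\<lambda>N. \<tau> / real N) (at_right 0) sequentially"
    unfolding filterlim_at using \<tau>
    by (auto intro!: tendsto_divide_0[OF tendsto_const] filterlim_real_sequentially filterlim_at_top_imp_at_infinity
        eventually_mono[OF eventually_gt_at_top[of 0]])
  have zero: "integral {0..\<tau>} (\<lambda>s. (t + \<tau> - s) powr (- \<beta> - 1) * g s) = 0" if t: "t > 0" for t
  proof -
    define F where "F s = (t + \<tau> - s) powr (- \<beta> - 1) * g s" for s
    define r where "r N j = nat \<lfloor>t / (\<tau> / real N)\<rfloor> + N - j" for N j :: nat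
    define u where "u N j = t + \<tau> - real (r N j) * (\<tau> / real N)" for N j :: nat
    have F: "continuous_on {0..\<tau>} F" unfolding F_def using kernel_integrable[OF cont t] by blast
    have tag: "u N j \<in> {real j * (\<tau> / real N)..real (Suc j) * (\<tau> / real N)}"
      and in_period: "u N j \<in> {0..\<tau>}" if "j < N" for N j
    proof -
      define h where "h = \<tau> / real N"
      have h: "h > 0" "real N * h = \<tau>" using \<tau> that by (auto simp: h_def)
      have "real (nat \<lfloor>t / h\<rfloor>) = of_int \<lfloor>t / h\<rfloor>" using t h by simp
      then have "real (nat \<lfloor>t / h\<rfloor>) \<le> t / h" "t / h < real (nat \<lfloor>t / h\<rfloor>) + 1" by linarith+
      then have M: "real (nat \<lfloor>t / h\<rfloor>) * h \<le> t" "t \<le> real (nat \<lfloor>t / h\<rfloor>) * h + h"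
        using h by (auto simp: field_simps)
      have r: "real (r N j) = real (nat \<lfloor>t / h\<rfloor>) + real N - real j"
        using that by (simp add: r_def h_def)
      \<comment> \<open>The sample point is \<open>j * h\<close> plus the remainder of
        \<open>t\<close> modulo \<open>h\<close>, so it lies in cell number
        \<open>j\<close>.\<close>
      have u: "u N j = t - real (nat \<lfloor>t / h\<rfloor>) * h + real j * h"
        using h by (simp add: u_def h_def[symmetric] r algebra_simps)
      show tg: "u N j \<in> {real j * (\<tau> / real N)..real (Suc j) * (\<tau> / real N)}"
        using M by (auto simp: h_def[symmetric] u algebra_simps)
      have "real (Suc j) * h \<le> real N * h" using that h by (intro mult_right_mono) auto
      moreover have "0 \<le> real j * h" using h by simp
      ultimately show "u N j \<in> {0..\<tau>}"
        using tg h unfolding h_def[symmetric] atLeastAtMost_iff by linarith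
    qed
    have quot: "GL_quotient \<beta> g (t + \<tau>) (\<tau> / real N) - GL_quotient \<beta> g t (\<tau> / real N)
        = (\<Sum>j<N. \<tau> / real N * (w (r N j) * F (u N j)))" if N: "N > 0" for N
    proof -
      define h where "h = \<tau> / real N"
      have h: "h > 0" using \<tau> N by (simp add: h_def)
      have "h powr (- \<beta>) * ((- 1) ^ (r N j) * (\<beta> gchoose (r N j)) * g (u N j))
          = h * (w (r N j) * F (u N j))" if j: "j < N" for j
      proof -
        have r: "real (r N j) > 0" using j by (simp add: r_def)
        \<comment> \<open>At \<open>s = u N j\<close> the base \<open>t + \<tau> - s\<close> is
          \<open>r N j * h\<close>: the powers of \<open>r N j\<close> in \<open>w\<close> and in
          \<open>F\<close> cancel, and \<open>h * h powr (- \<beta> - 1)\<close> is the prefactor of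
          the quotient.\<close>
        have "h * (real (r N j) powr (\<beta> + 1) * (real (r N j) * h) powr (- \<beta> - 1))
            = h * h powr (- \<beta> - 1) * (real (r N j) powr (\<beta> + 1) * real (r N j) powr (- \<beta> - 1))"
          using h r by (simp add: powr_mult)
        also have "\<dots> = h powr (- \<beta>)"
          using h r by (simp add: powr_add[symmetric] powr_mult_base)
        finally show ?thesis by (simp add: w_def F_def u_def h_def[symmetric] mult_ac)
      qed
      then have "(\<Sum>j<N. h * (w (r N j) * F (u N j)))
          = h powr (- \<beta>) * (\<Sum>j<N. (- 1) ^ (r N j) * (\<beta> gchoose (r N j)) * g (u N j))"
        by (simp add: sum_distrib_left)
      then show ?thesis
        using GL_quotient_shift[OF per less_imp_le[OF t] N, of \<beta>] by (simp add: h_def r_def u_def)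
    qed
    have lim: "(\<lambda>N. GL_quotient \<beta> g s (\<tau> / real N)) \<longlonglongrightarrow> GL_deriv \<beta> g s" if s: "s \<ge> 0" for s
    proof -
      obtain l where l: "(GL_quotient \<beta> g s \<longlongrightarrow> l) (at_right 0)"
        using diff s by (auto simp: GL_differentiable_def)
      then have "GL_deriv \<beta> g s = l" unfolding GL_deriv_def by (intro tendsto_Lim) auto
      with l show ?thesis using filterlim_compose[OF _ steps] by metis
    qed
    have "(\<lambda>N. GL_quotient \<beta> g (t + \<tau>) (\<tau> / real N) - GL_quotient \<beta> g t (\<tau> / real N)) \<longlonglongrightarrow>
        GL_deriv \<beta> g (t + \<tau>) - GL_deriv \<beta> g t"
      using t \<tau> by (intro tendsto_diff lim) auto
    then have lim0: "(\<lambda>N. GL_quotient \<beta> g (t + \<tau>) (\<tau> / real N) - GL_quotient \<beta> g t (\<tau> / real N)) \<longlonglongrightarrow> 0"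
      using D t by (simp add: periodic_with_def)
    have "(\<lambda>N. \<Sum>j<N. \<tau> / real N * (w (r N j) * F (u N j))) \<longlonglongrightarrow> 0"
      by (rule Lim_transform_eventually[OF lim0 eventually_mono[OF eventually_gt_at_top[of 0]]])
        (use quot in auto)
    moreover have "(\<lambda>N. \<Sum>j<N. \<tau> / real N * (w (r N j) * F (u N j)))
        \<longlonglongrightarrow> integral {0..\<tau>} (\<lambda>s. L * F s)"
    proof (rule uniform_Riemann_sums_tendsto)
      fix e :: real assume e: "e > 0"
      have "compact (F ` {0..\<tau>})" using F by (intro compact_continuous_image) auto
      then obtain B where B: "B > 0" "\<And>s. s \<in> {0..\<tau>} \<Longrightarrow> \<bar>F s\<bar> \<le> B"
        by (auto dest!: compact_imp_bounded simp: bounded_pos)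
      have "uniformly_continuous_on {0..\<tau>} F" using F by (intro compact_uniformly_continuous) auto
      moreover have "e / (2 * \<bar>L\<bar>) > 0" using e L by simp
      ultimately obtain d where d: "d > 0" "\<And>s s'. s \<in> {0..\<tau>} \<Longrightarrow> s' \<in> {0..\<tau>} \<Longrightarrow> \<bar>s' - s\<bar> < d
          \<Longrightarrow> \<bar>F s' - F s\<bar> < e / (2 * \<bar>L\<bar>)"
        unfolding uniformly_continuous_on_def dist_real_def by metis
      have "e / (2 * B) > 0" using e B by simp
      then obtain R where R: "\<And>r. r \<ge> R \<Longrightarrow> \<bar>w r - L\<bar> < e / (2 * B)"
        using LIMSEQ_D[OF w] by (metis real_norm_def)
      have "(\<lambda>N. \<tau> / real N) \<longlonglongrightarrow> 0" using steps by (simp add: filterlim_at)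
      then have "\<forall>\<^sub>F N in sequentially. \<tau> / real N < min d (t / (real R + 1))"
        using d t by (intro order_tendstoD) auto
      then show "\<forall>\<^sub>F N in sequentially. \<forall>j<N.
          \<forall>s\<in>{real j * (\<tau> / N)..real (Suc j) * (\<tau> / N)}. \<bar>w (r N j) * F (u N j) - L * F s\<bar> \<le> e"
        using eventually_gt_at_top[of 0]
      proof (eventually_elim, intro allI impI ballI)
        fix N j :: nat and s
        assume small: "\<tau> / real N < min d (t / (real R + 1))" and N: "N > 0" and j: "j < N"
          and s: "s \<in> {real j * (\<tau> / N)..real (Suc j) * (\<tau> / N)}"
        define h where "h = \<tau> / real N"
        have h: "h > 0" "real N * h = \<tau>" "h < d" "h * (real R + 1) < t"
          using \<tau> N small by (auto simp: h_def field_simps)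
        \<comment> \<open>All unmatched indices exceed \<open>\<lfloor>t / h\<rfloor>\<close>, which
          grows without bound as \<open>t > 0\<close>; so a small step brings every weight close to
          \<open>L\<close> simultaneously.\<close>
        have "real R + 1 \<le> t / h" using h by (simp add: field_simps)
        then have "R \<le> nat \<lfloor>t / h\<rfloor>" by linarith
        then have "R \<le> r N j" using j by (simp add: r_def h_def)
        then have 1: "\<bar>w (r N j) - L\<bar> \<le> e / (2 * B)" using R by (simp add: less_imp_le)
        have "real (Suc j) * h \<le> real N * h" using j h by (intro mult_right_mono) auto
        moreover have "0 \<le> real j * h" using h by simp
        ultimately have s': "s \<in> {0..\<tau>}"
          using s h unfolding h_def[symmetric] atLeastAtMost_iff by linarith
        have "\<bar>u N j - s\<bar> < d"
          using s tag[OF j] h(3) unfolding h_def[symmetric] by (auto simp: algebra_simps)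
        then have 2: "\<bar>F (u N j) - F s\<bar> \<le> e / (2 * \<bar>L\<bar>)"
          using d(2)[OF s' in_period[OF j]] by simp
        \<comment> \<open>The error splits into that of the weight, controlled by the bound
          \<open>B\<close> on \<open>F\<close>, and that of the sample point, controlled by uniform
          continuity; each gets \<open>e / 2\<close>.\<close>
        have "w (r N j) * F (u N j) - L * F s = (w (r N j) - L) * F (u N j) + L * (F (u N j) - F s)"
          by (simp add: algebra_simps)
        then have "\<bar>w (r N j) * F (u N j) - L * F s\<bar>
            \<le> \<bar>w (r N j) - L\<bar> * \<bar>F (u N j)\<bar> + \<bar>L\<bar> * \<bar>F (u N j) - F s\<bar>"
          by (metis abs_mult abs_triangle_ineq)
        also have "\<dots> \<le> e / (2 * B) * B + \<bar>L\<bar> * (e / (2 * \<bar>L\<bar>))"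
          using 1 2 B in_period[OF j] e by (intro add_mono mult_mono) auto
        also have "\<dots> = e" using B L by simp
        finally show "\<bar>w (r N j) * F (u N j) - L * F s\<bar> \<le> e" .
      qed
    qed (use F \<tau> in \<open>auto intro!: continuous_intros\<close>)
    ultimately have "integral {0..\<tau>} (\<lambda>s. L * F s) = 0" using LIMSEQ_unique by blast
    then show ?thesis using L by (simp add: F_def)
  qed
  have "g t = 0" if "t \<ge> 0" for t
  proof (rule zero_on_period_imp_zero[OF per _ that])
    show "g s = 0" if "s \<in> {0..\<tau>}" for s
      by (rule kernel_orthogonal_imp_zero[OF cont \<tau> _ zero that]) (use \<beta> in auto)
  qed
  then show ?thesis by (auto simp: constant_fun_def)
qed

section \<open>From scalar functions to the autonomous system\<close>

lemma periodic_frac_deriv_imp_constant: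
  assumes "\<beta> > 0" "\<beta> \<notin> \<nat>" "periodic_with \<tau> g" "C_class (frac_ord \<beta>) g"
    and "frac_differentiable \<kappa> \<beta> g" "periodic_with \<tau> (frac_deriv \<kappa> \<beta> g)"
  shows "constant_fun g"
proof -
  have "continuous_on {0..\<tau>} g"
    using assms(4) by (intro continuous_on_Icc_of_times_differentiable) (auto simp: C_class_def)
  then show ?thesis
    using assms periodic_RL_imp_constant periodic_Caputo_imp_constant periodic_GL_imp_constant
    by (cases \<kappa>) auto
qed

theorem corollary3:
  fixes \<alpha> :: "real ^ 'p::finite"
    and m :: nat
    and f :: "real \<Rightarrow> (real ^ 'p) list \<Rightarrow> real ^ 'p"
    and K :: "'p \<Rightarrow> frac_kind"
  assumes "\<And>i. \<alpha> $ i > 0"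
    and "\<And>i. \<alpha> $ i \<notin> \<nat>"
    and "autonomous m f"
  shows "\<not> (\<exists>x \<tau>. periodic_with \<tau> x \<and> \<not> constant_fun x \<and>
            C_class_vec (\<lambda>i. nat \<lfloor>\<alpha> $ i\<rfloor> + 1) x \<and> frac_solution K \<alpha> m f x)"
proof (intro notI, elim exE conjE)
  fix x \<tau>
  assume per: "periodic_with \<tau> x" and nonconst: "\<not> constant_fun x"
    and C: "C_class_vec (\<lambda>i. nat \<lfloor>\<alpha> $ i\<rfloor> + 1) x" and sol: "frac_solution K \<alpha> m f x"
  have \<tau>: "\<tau> > 0" using per by (simp add: periodic_with_def)
  have td: "times_differentiable m x"
    and eq: "\<And>t. t \<ge> 0 \<Longrightarrow> (\<chi> i. frac_deriv (K i) (\<alpha> $ i) (\<lambda>s. x s $ i) t) =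
        f t (map (\<lambda>k. nderiv k x t) [0..<m + 1])"
    using sol by (auto simp: frac_solution_def)
  \<comment> \<open>The system is used only to see that the fractional derivative of each component
    is periodic; after that the components, possibly with different kinds of derivative, are
    independent scalar problems.\<close>
  have "constant_fun (\<lambda>s. x s $ i)" for i
  proof (rule periodic_frac_deriv_imp_constant)
    show "periodic_with \<tau> (frac_deriv (K i) (\<alpha> $ i) (\<lambda>s. x s $ i))"
      unfolding periodic_with_def
    proof (intro conjI allI impI)
      fix t :: real assume t: "t \<ge> 0"
      have t': "t + \<tau> \<ge> 0" using t \<tau> by simp
      have map_eq: "map (\<lambda>k. nderiv k x (t + \<tau>)) [0..<m + 1] = map (\<lambda>k. nderiv k x t) [0..<m + 1]"
        using periodic_with_nderiv[OF td per] t by (intro map_cong) (auto simp: periodic_with_def)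
      \<comment> \<open>Autonomy enters here: once the lists of derivatives agree, the two
        right-hand sides differ only in their time argument.\<close>
      have "f (t + \<tau>) (map (\<lambda>k. nderiv k x t) [0..<m + 1]) =
          f t (map (\<lambda>k. nderiv k x t) [0..<m + 1])"
        using assms(3)[unfolded autonomous_def, rule_format, of "t + \<tau>" t] t \<tau>
        by (simp del: upt_Suc)
      then have "(\<chi> i. frac_deriv (K i) (\<alpha> $ i) (\<lambda>s. x s $ i) (t + \<tau>)) =
          (\<chi> i. frac_deriv (K i) (\<alpha> $ i) (\<lambda>s. x s $ i) t)"
        unfolding eq[OF t] eq[OF t'] map_eq .
      then show "frac_deriv (K i) (\<alpha> $ i) (\<lambda>s. x s $ i) (t + \<tau>) = frac_deriv (K i) (\<alpha> $ i) (\<lambda>s. x s $ i) t"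
        by (simp add: vec_eq_iff)
    qed (rule \<tau>)
  qed (use assms per C sol in \<open>auto simp: periodic_with_def C_class_vec_def frac_ord_def frac_solution_def\<close>)
  then have "\<exists>c. \<forall>t\<ge>0. x t $ i = c" for i by (simp add: constant_fun_def)
  then obtain c where "\<And>i t. t \<ge> 0 \<Longrightarrow> x t $ i = c i" by metis
  then have "\<forall>t\<ge>0. x t = (\<chi> i. c i)" by (simp add: vec_eq_iff)
  then show False using nonconst by (auto simp: constant_fun_def)
qed

end
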